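(* Let $f:\mathbb{R}^d\to\mathbb{R}$, $\mathcal M$, $\alpha$, $\mathcal U_\alpha$, $\pi$ and $\mu>0$ satisfy the standing assumptions (1)-(4) listed in the context. Let $\gamma = 2\sqrt{\mu}$ and let $x_0\in\mathbb{R}^d$ satisfy $f(x_0)<\alpha$. Then there exists a unique solution $x(t)=x_t$, $t\ge 0$, of the heavy ball ODE $$\ddot x + \gamma\,\dot x = -\nabla f(x),\qquad x(0)=x_0,\qquad \dot x(0)=0,$$ and $f(x_t)<\alpha$ for all $t>0$. Furthermore, $x$ is $C^2$-smooth and for all $t\geq 0$ $$f(x_t)-\inf_{z\in\mathbb{R}^d} f(z) \le e^{-\sqrt{\mu}\,t}\left(f(x_0)-\inf_{z\in\mathbb{R}^d} f(z)+\frac{\mu}{2}\,\mathrm{dist}(x_0,\mathcal M)^2\right).$$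
   Context: Standing assumptions: (1) $f:\mathbb{R}^d\to\mathbb{R}$ is bounded from below, $C^1$-smooth, and its gradient $\nabla f:\mathbb{R}^d\to\mathbb{R}^d$ is locally Lipschitz continuous. (2) The set $\mathcal M=\{x\in\mathbb{R}^d: f(x)=\inf_{z\in\mathbb{R}^d} f(z)\}$ of minimizers of $f$ is a non-empty $k$-dimensional $C^2$-submanifold of $\mathbb{R}^d$ with $k<d$. (3) There is an open sub-level set $\mathcal U_\alpha=\{x\in\mathbb{R}^d: f(x)<\alpha\}$, for some $\alpha>0$, such that for every $x\in\mathcal U_\alpha$ there exists a unique point of $\mathcal M$ closest to $x$; this point is denoted $\pi(x)$, and the closest point projection $\pi:\mathcal U_\alpha\to\mathcal M$ is $C^1$-smooth. (4) $f$ satisfies the $\mu$-strong aiming condition in $\mathcal U_\alpha$ (with $\mu>0$): $$\nabla f(x)\cdot(x-\pi(x))\ge f(x)-f(\pi(x))+\frac{\mu}{2}\|x-\pi(x)\|^2\qquad\text{for all }x\in\mathcal U_\alpha.$$ $\|\cdot\|$ is the Euclidean norm and $\mathrm{dist}(x,\mathcal M)=\inf_{z\in\mathcal M}\|x-z\|$. *)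

theory Defs
  imports "HOL-Analysis.Analysis"
begin

text \<open>Continuous differentiability in the Frechet sense. Derivatives are taken within \<open>S\<close>: this is
  the ordinary derivative if \<open>S\<close> is open, and for \<open>S = {0..}\<close> it is one-sided at \<open>0\<close>. Only these two
  kinds of domain are used.\<close>

definition C1_on :: "'a::real_normed_vector set \<Rightarrow> ('a \<Rightarrow> 'b::real_normed_vector) \<Rightarrow> bool" where
  "C1_on S g \<longleftrightarrow> (\<exists>g' :: 'a \<Rightarrow> 'a \<Rightarrow>\<^sub>L 'b.
     (\<forall>x\<in>S. (g has_derivative blinfun_apply (g' x)) (at x within S)) \<and> continuous_on S g')"

definition C2_on :: "'a::real_normed_vector set \<Rightarrow> ('a \<Rightarrow> 'b::real_normed_vector) \<Rightarrow> bool" where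
  "C2_on S g \<longleftrightarrow> (\<exists>g' :: 'a \<Rightarrow> 'a \<Rightarrow>\<^sub>L 'b.
     (\<forall>x\<in>S. (g has_derivative blinfun_apply (g' x)) (at x within S)) \<and> C1_on S g')"

definition gradient :: "('a::real_inner \<Rightarrow> real) \<Rightarrow> 'a \<Rightarrow> 'a" where
  "gradient f x = (THE D. GDERIV f x :> D)"

definition locally_lipschitz :: "('a::metric_space \<Rightarrow> 'b::metric_space) \<Rightarrow> bool" where
  "locally_lipschitz g \<longleftrightarrow> (\<forall>x. \<exists>r>0. \<exists>L. L-lipschitz_on (cball x r) g)"

definition minimizers :: "('a \<Rightarrow> real) \<Rightarrow> 'a set" where
  "minimizers f = {x. f x = (INF z. f z)}"

text \<open>Embedded submanifolds via slice charts: locally, an ambient \<open>C\<^sup>2\<close>-diffeomorphism straightens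
  \<open>M\<close> to a \<open>k\<close>-dimensional coordinate subspace. As the coordinates are indexed by the unordered type
  \<open>'d\<close>, the model space \<open>\<real>\<^sup>k \<times> {0}\<close> is given by a set \<open>I\<close> of \<open>k\<close> coordinates that may be nonzero.\<close>

definition C2_submanifold :: "nat \<Rightarrow> (real ^ 'd) set \<Rightarrow> bool" where
  "C2_submanifold k M \<longleftrightarrow> (\<forall>p\<in>M. \<exists>U V (\<phi> :: real ^ 'd \<Rightarrow> real ^ 'd) \<psi> (I :: 'd set).
     open U \<and> p \<in> U \<and> open V \<and> homeomorphism U V \<phi> \<psi> \<and> C2_on U \<phi> \<and> C2_on V \<psi> \<and>
     card I = k \<and> \<phi> ` (M \<inter> U) = V \<inter> {y. \<forall>i. i \<notin> I \<longrightarrow> y $ i = 0})"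

definition sublevel :: "('a \<Rightarrow> real) \<Rightarrow> real \<Rightarrow> 'a set" where
  "sublevel f \<alpha> = {x. f x < \<alpha>}"

definition strong_aiming :: "('a::euclidean_space \<Rightarrow> real) \<Rightarrow> ('a \<Rightarrow> 'a) \<Rightarrow> real \<Rightarrow> 'a set \<Rightarrow> bool" where
  "strong_aiming f \<pi> \<mu> U \<longleftrightarrow>
     (\<forall>x\<in>U. gradient f x \<bullet> (x - \<pi> x) \<ge> f x - f (\<pi> x) + \<mu> / 2 * (norm (x - \<pi> x))\<^sup>2)"

text \<open>Classical (twice differentiable) solutions on \<open>[0,\<infinity>)\<close>, with \<open>v\<close> and \<open>a\<close> the first and second
  derivative of \<open>x\<close>. The values of \<open>x\<close> at negative times are irrelevant.\<close>

definition heavy_ball_solution ::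
  "('a::real_inner \<Rightarrow> real) \<Rightarrow> real \<Rightarrow> 'a \<Rightarrow> (real \<Rightarrow> 'a) \<Rightarrow> bool" where
  "heavy_ball_solution f \<gamma> x0 x \<longleftrightarrow> (\<exists>v a.
     (\<forall>t\<ge>0. (x has_vector_derivative v t) (at t within {0..}) \<and>
            (v has_vector_derivative a t) (at t within {0..}) \<and>
            a t + \<gamma> *\<^sub>R v t = - gradient f (x t)) \<and>
     x 0 = x0 \<and> v 0 = 0)"

end

theory Submission
  imports Defs
begin

text \<open>
  Write \<open>s = \<surd>\<mu>\<close>, \<open>m = inf f\<close> and \<open>n = x - \<pi> x\<close>. Everything rests on the Lyapunov function
  \<open>L = f x - m + \<parallel>v + s n\<parallel>\<^sup>2 / 2\<close> along a solution with velocity \<open>v\<close>. Differentiating \<open>L\<close> and inserting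
  \<open>v' = - \<nabla>f x - 2 s v\<close>, the terms in \<open>v \<bullet> \<nabla>f x\<close> cancel. What is left is controlled by strong aiming and
  by two facts on the derivative \<open>P\<close> of \<open>\<pi>\<close> at \<open>x\<close>: the vector \<open>n\<close> is orthogonal to the range of \<open>P\<close>,
  because \<open>\<pi> x\<close> minimizes the distance to \<open>x\<close> among all values of \<open>\<pi>\<close>, and \<open>v \<bullet> P v \<ge> 0\<close>, because a
  nearest-point map is monotone. Both follow from the nearest-point property to first order. The outcome is
  \<open>L' \<le> - s (L + \<parallel>v\<parallel>\<^sup>2 / 2)\<close> (\<open>lyapunov_dissipation\<close>).

  Dropping \<open>\<parallel>v\<parallel>\<^sup>2\<close>, Gronwall's inequality gives the claimed rate, since \<open>L\<close> dominates \<open>f x - m\<close> and its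
  initial value is \<open>f x0 - m + \<mu> / 2 dist\<^sup>2\<close>. All of this needs the trajectory to stay in the sublevel
  set on which \<open>\<pi>\<close> is smooth; it does, as the mechanical energy \<open>f x + \<parallel>v\<parallel>\<^sup>2 / 2\<close> does not increase.

  Existence for all times uses the term \<open>\<parallel>v\<parallel>\<^sup>2\<close>: it makes \<open>exp (s t) \<parallel>v\<parallel>\<^sup>2\<close> integrable, hence the
  trajectory has finite length, with the explicit bound \<open>(L 0 + 1/2) / s\<close> on the distance to the
  starting point, uniformly in time (\<open>arc_length_bound\<close>). Replacing \<open>\<nabla>f\<close> by its composition with the
  projection onto a slightly larger ball gives a globally Lipschitz equation, which has a solution on
  \<open>[0,\<infinity>)\<close> by Banach's fixed point theorem in an exponentially weighted space
  (\<open>global_solution_of_lipschitz_ode\<close>). A continuity argument shows that this solution never feels the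
  truncation. Uniqueness is Gronwall's inequality once more, on a compact set containing both
  trajectories.
\<close>

section \<open>Comparison principles on an interval\<close>

text \<open>The weighted function \<open>exp (- c t) D t\<close> does not increase. The constant \<open>c\<close> may have either sign: a
  positive one yields uniqueness, \<open>0\<close> monotonicity of the energy, a negative one decay.\<close>

lemma gronwall_interval:
  fixes D :: "real \<Rightarrow> real"
  assumes D: "\<And>t. t \<in> {0..\<tau>} \<Longrightarrow> (D has_real_derivative D' t) (at t within {0..\<tau>})"
    and le: "\<And>t. t \<in> {0..\<tau>} \<Longrightarrow> D' t \<le> c * D t"
    and t: "t \<in> {0..\<tau>}"
  shows "D t \<le> exp (c * t) * D 0"
proof -
  have "exp (- c * t) * D t \<le> exp (- c * 0) * D 0"
  proof (rule DERIV_nonpos_imp_decreasing_open[where f = "\<lambda>s. exp (- c * s) * D s"])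
    fix s assume s: "0 < s" "s < t"
    have "(D has_real_derivative D' s) (at s)"
      using D[of s] s t by (simp add: at_within_Icc_at)
    then have "((\<lambda>s. exp (- c * s) * D s) has_real_derivative exp (- c * s) * (D' s - c * D s)) (at s)"
      by (auto intro!: derivative_eq_intros simp: algebra_simps)
    moreover have "exp (- c * s) * (D' s - c * D s) \<le> 0"
      using le[of s] s t by (simp add: mult_le_0_iff)
    ultimately show "\<exists>y. ((\<lambda>s. exp (- c * s) * D s) has_real_derivative y) (at s) \<and> y \<le> 0"
      by blast
  next
    have "continuous_on {0..\<tau>} D"
      using D by (rule DERIV_continuous_on)
    then show "continuous_on {0..t} (\<lambda>s. exp (- c * s) * D s)"
      using t by (auto intro!: continuous_intros intro: continuous_on_subset)
  qed (use t in auto)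
  then show ?thesis
    by (simp add: exp_minus field_simps)
qed

text \<open>An a priori bound \<open>R'\<close> that improves itself to a smaller \<open>R\<close> holds for all times: on its way to \<open>R'\<close>,
  \<open>\<phi>\<close> would have to pass through the forbidden gap between \<open>R\<close> and \<open>R'\<close>.\<close>

lemma continuity_bootstrap:
  fixes \<phi> :: "real \<Rightarrow> real"
  assumes cont: "continuous_on {0..} \<phi>" and "\<phi> 0 \<le> R" "R < R'"
    and improve: "\<And>\<tau>. 0 \<le> \<tau> \<Longrightarrow> (\<And>t. t \<in> {0..\<tau>} \<Longrightarrow> \<phi> t \<le> R') \<Longrightarrow> \<phi> \<tau> \<le> R"
    and "0 \<le> T"
  shows "\<phi> T \<le> R"
proof (rule ccontr)
  assume T: "\<not> \<phi> T \<le> R"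
  define S where "S = {t \<in> {0..T}. R' \<le> \<phi> t}"
  have "closed S"
    unfolding S_def using continuous_on_subset[OF cont, of "{0..T}"]
    by (intro continuous_on_closed_Collect_le continuous_on_const) auto
  moreover have "bounded S"
    by (rule bounded_subset[of "{0..T}"]) (auto simp: S_def)
  ultimately have "compact S"
    by (simp add: compact_eq_bounded_closed)
  moreover have "S \<noteq> {}"
  proof
    assume "S = {}"
    then have "\<phi> t \<le> R'" if "t \<in> {0..T}" for t
      using that unfolding S_def by (metis (mono_tags, lifting) empty_Collect_eq linear)
    then show False
      using improve[OF \<open>0 \<le> T\<close>] T by blast
  qed
  ultimately have "\<exists>\<tau>\<in>S. \<forall>t\<in>S. \<tau> \<le> t"
    by (rule compact_attains_inf)
  then obtain \<tau> where \<tau>: "\<tau> \<in> S" "\<And>t. t \<in> S \<Longrightarrow> \<tau> \<le> t"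
    by blast
  \<comment> \<open>\<open>\<tau>\<close> is the first time at which \<open>\<phi>\<close> reaches \<open>R'\<close>; just before it, \<open>\<phi>\<close> crosses the middle of the gap.\<close>
  have "\<exists>\<sigma>\<ge>0. \<sigma> \<le> \<tau> \<and> \<phi> \<sigma> = (R + R') / 2"
    using \<tau>(1) assms(2,3) continuous_on_subset[OF cont, of "{0..\<tau>}"]
    by (intro IVT') (auto simp: S_def)
  then obtain \<sigma> where \<sigma>: "0 \<le> \<sigma>" "\<sigma> \<le> \<tau>" "\<phi> \<sigma> = (R + R') / 2"
    by blast
  with \<tau>(1) \<open>R < R'\<close> have "\<sigma> < \<tau>"
    by (cases "\<sigma> = \<tau>") (auto simp: S_def)
  have "\<phi> t \<le> R'" if "t \<in> {0..\<sigma>}" for t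
  proof (rule ccontr)
    assume "\<not> \<phi> t \<le> R'"
    then have "t \<in> S"
      using that \<open>\<sigma> < \<tau>\<close> \<tau>(1) by (simp add: S_def)
    then show False
      using \<tau>(2)[of t] that \<open>\<sigma> < \<tau>\<close> by simp
  qed
  then have "\<phi> \<sigma> \<le> R"
    using improve[OF \<sigma>(1)] by blast
  then show False
    using \<sigma>(3) \<open>R < R'\<close> by simp
qed

section \<open>The derivative of a nearest-point map\<close>

text \<open>First-order optimality: \<open>y \<mapsto> \<parallel>x - p y\<parallel>\<^sup>2\<close> has a minimum at \<open>y = x\<close>. When \<open>p\<close> is the projection onto a
  manifold, this says that \<open>x - p x\<close> is normal to it.\<close>

lemma nearest_point_map_derivative_orthogonal:
  fixes p :: "'a::real_inner \<Rightarrow> 'a"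
  assumes "open U" "x \<in> U"
    and nearest: "\<And>y. y \<in> U \<Longrightarrow> dist x (p x) \<le> dist x (p y)"
    and p': "(p has_derivative p') (at x)"
  shows "(x - p x) \<bullet> p' h = 0"
proof -
  let ?\<delta> = "\<lambda>y. (x - p y) \<bullet> (x - p y)"
  have "(?\<delta> has_derivative (\<lambda>h. - 2 * ((x - p x) \<bullet> p' h))) (at x)"
    by (rule derivative_eq_intros p' refl)+ (auto simp: inner_commute)
  moreover have "eventually (\<lambda>y. ?\<delta> x \<le> ?\<delta> y) (at x)"
    using eventually_at_in_open'[OF assms(1,2)]
    by eventually_elim (use nearest in \<open>simp add: dist_norm norm_le\<close>)
  ultimately have "(\<lambda>h. - 2 * ((x - p x) \<bullet> p' h)) = (\<lambda>h. 0)"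
    by (rule has_derivative_local_min)
  then show ?thesis
    by (metis mult_eq_0_iff neg_equal_0_iff_equal zero_neq_numeral)
qed

text \<open>The projection onto any set, convex or not, is a monotone operator: on adding the two squared
  inequalities all square terms cancel.\<close>

lemma nearest_point_map_monotone:
  fixes x y :: "'a::real_inner"
  assumes "dist x p \<le> dist x q" "dist y q \<le> dist y p"
  shows "0 \<le> (x - y) \<bullet> (p - q)"
  using assms by (simp add: dist_norm norm_le inner_simps inner_commute)

text \<open>The derivative of a monotone operator is positive semidefinite: the difference quotients of
  \<open>r \<mapsto> h \<bullet> p (x + r h)\<close> at \<open>0\<close> are nonnegative.\<close>

lemma nearest_point_map_derivative_nonneg:
  fixes p :: "'a::real_inner \<Rightarrow> 'a"
  assumes "open U" "x \<in> U"
    and nearest: "\<And>y z. y \<in> U \<Longrightarrow> z \<in> U \<Longrightarrow> dist y (p y) \<le> dist y (p z)"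
    and p': "(p has_derivative p') (at x)"
  shows "0 \<le> h \<bullet> p' h"
proof -
  let ?q = "\<lambda>r::real. h \<bullet> p (x + r *\<^sub>R h)"
  interpret p': bounded_linear p'
    using p' by (rule has_derivative_bounded_linear)
  have line: "((\<lambda>r. x + r *\<^sub>R h) has_derivative (\<lambda>r. r *\<^sub>R h)) (at 0)"
    by (auto intro!: derivative_eq_intros)
  have "(?q has_derivative (\<lambda>r. h \<bullet> p' (r *\<^sub>R h))) (at 0)"
    by (rule has_derivative_inner_right has_derivative_compose[OF line] )+ (use p' in simp)
  then have "(?q has_real_derivative h \<bullet> p' h) (at 0)"
    by (simp add: has_field_derivative_def p'.scaleR mult.commute[of _ "h \<bullet> p' h"])
  then have lim: "((\<lambda>r. (?q r - ?q 0) / r) \<longlongrightarrow> h \<bullet> p' h) (at 0)"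
    by (simp add: has_field_derivative_iff)
  have "open ((\<lambda>r::real. x + r *\<^sub>R h) -` U)"
    by (intro open_vimage continuous_intros assms(1))
  then have "\<forall>\<^sub>F r in at (0::real). r \<in> (\<lambda>r. x + r *\<^sub>R h) -` U - {0}"
    using assms(2) by (intro eventually_at_in_open) auto
  then have "\<forall>\<^sub>F r in at 0. 0 \<le> (?q r - ?q 0) / r"
  proof eventually_elim
    fix r :: real assume r: "r \<in> (\<lambda>r. x + r *\<^sub>R h) -` U - {0}"
    have "0 \<le> (x + r *\<^sub>R h - x) \<bullet> (p (x + r *\<^sub>R h) - p x)"
      using r assms(2) by (intro nearest_point_map_monotone nearest) auto
    then have "0 \<le> r * (?q r - ?q 0)"
      by (simp add: inner_diff_right right_diff_distrib)
    then show "0 \<le> (?q r - ?q 0) / r"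
      by (auto simp: zero_le_mult_iff zero_le_divide_iff)
  qed
  then show ?thesis
    by (intro tendsto_lowerbound[OF lim]) auto
qed

section \<open>Locally Lipschitz maps\<close>

lemma locally_lipschitz_imp_continuous:
  assumes "locally_lipschitz g"
  shows "continuous_on UNIV g"
proof (rule continuous_at_imp_continuous_on, rule ballI)
  fix x
  obtain r L where "r > 0" "L-lipschitz_on (cball x r) g"
    using assms unfolding locally_lipschitz_def by blast
  then have "continuous_on (ball x r) g" "x \<in> ball x r"
    by (auto intro: lipschitz_on_continuous_on continuous_on_subset ball_subset_cball)
  then show "isCont g x"
    by (simp add: continuous_on_eq_continuous_at)
qed

lemma locally_lipschitz_imp_lipschitz_on_compact:
  fixes g :: "'a::metric_space \<Rightarrow> 'b::metric_space"
  assumes "locally_lipschitz g" "compact B"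
  obtains K where "K-lipschitz_on B g"
proof -
  have "local_lipschitz {0::real} B (\<lambda>_. g)"
  proof (rule local_lipschitzI)
    fix x
    obtain r L where "r > 0" "L-lipschitz_on (cball x r) g"
      using assms(1) unfolding locally_lipschitz_def by blast
    then show "\<exists>u>0. \<exists>L. \<forall>s\<in>cball t u \<inter> {0}. L-lipschitz_on (cball x u \<inter> B) g" for t :: real
      by (blast intro: lipschitz_on_subset)
  qed
  then show ?thesis
    by (rule local_lipschitz_compact_implies_lipschitz[OF _ assms(2)]) (auto intro: that)
qed

section \<open>Global solutions of Lipschitz ODEs\<close>

text \<open>Integration gains a factor \<open>1 / \<kappa>\<close> in the norm weighted by \<open>exp (- \<kappa> t)\<close>, whatever the length of the
  time interval. This is what turns Picard's operator into a contraction on the whole half-line.\<close>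

lemma exp_weighted_integral_bound:
  fixes h :: "real \<Rightarrow> 'a::banach"
  assumes "0 < \<kappa>" "0 \<le> t" "0 \<le> C"
    and h: "continuous_on {0..t} h" "\<And>s. s \<in> {0..t} \<Longrightarrow> norm (h s) \<le> C * exp (\<kappa> * s)"
  shows "norm (exp (- \<kappa> * t) *\<^sub>R integral {0..t} h) \<le> C / \<kappa>"
proof -
  have "((\<lambda>s. C * exp (\<kappa> * s)) has_integral C / \<kappa> * exp (\<kappa> * t) - C / \<kappa> * exp (\<kappa> * 0)) {0..t}"
    using assms by (intro fundamental_theorem_of_calculus)
      (auto intro!: derivative_eq_intros simp flip: has_real_derivative_iff_has_vector_derivative)
  then have "norm (integral {0..t} h) \<le> C / \<kappa> * exp (\<kappa> * t) - C / \<kappa>"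
    using integral_norm_bound_integral[of h "{0..t}" "\<lambda>s. C * exp (\<kappa> * s)"] h
    by (metis (no_types, lifting) exp_zero has_integral_iff integrable_continuous_interval mult.right_neutral mult_zero_right)
  also have "\<dots> \<le> C / \<kappa> * exp (\<kappa> * t)"
    using assms by simp
  finally have "exp (- \<kappa> * t) * norm (integral {0..t} h) \<le> exp (- \<kappa> * t) * (C / \<kappa> * exp (\<kappa> * t))"
    by (rule mult_left_mono) simp
  then show ?thesis
    by (simp add: exp_minus field_simps)
qed

text \<open>The unknown of the fixed point problem is \<open>w t = exp (- \<kappa> t) z t\<close>, which stays bounded for
  \<open>\<kappa> > K\<close>; so the space of bounded continuous functions is available although \<open>z\<close> itself may grow
  exponentially. Picard's operator then contracts by the factor \<open>K / \<kappa>\<close>.\<close>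

lemma global_solution_of_lipschitz_ode:
  fixes G :: "'a::banach \<Rightarrow> 'a"
  assumes G: "K-lipschitz_on UNIV G"
  obtains z where "z 0 = z0" "\<And>t. 0 \<le> t \<Longrightarrow> (z has_vector_derivative G (z t)) (at t within {0..})"
proof -
  define \<kappa> where "\<kappa> = K + 1"
  have K: "0 \<le> K" "0 < \<kappa>" "K / \<kappa> < 1"
    using lipschitz_on_nonneg[OF G] by (auto simp: \<kappa>_def)
  have GK: "norm (G a - G b) \<le> K * norm (a - b)" for a b
    using lipschitz_on_normD[OF G] by simp
  have contG: "continuous_on UNIV G"
    using G by (rule lipschitz_on_continuous_on)
  let ?h = "\<lambda>(w :: real \<Rightarrow>\<^sub>C 'a) s. G (exp (\<kappa> * s) *\<^sub>R w s)"
  have cont_h: "continuous_on S (?h w)" for w S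
    by (intro continuous_on_compose2[OF contG] continuous_intros) auto
  have integral_deriv: "((\<lambda>u. integral {0..u} (?h w)) has_vector_derivative ?h w t) (at t within {0..})"
    if "0 \<le> t" for w t
  proof -
    have "((\<lambda>u. integral {0..u} (?h w)) has_vector_derivative ?h w t) (at t within {0..t + 1})"
      using that by (intro integral_has_vector_derivative cont_h) auto
    moreover have "at t within {0..t + 1} = at t within {0..}"
      by (rule at_within_nhd[of _ "{..<t + 1}"]) auto
    ultimately show ?thesis
      by simp
  qed
  \<comment> \<open>Times are clamped to \<open>[0,\<infinity>)\<close>, since the functions of the complete space are defined on all of \<open>\<real>\<close>.\<close>
  define P where "P w t = exp (- \<kappa> * max 0 t) *\<^sub>R (z0 + integral {0..max 0 t} (?h w))" for w t
  have P_bcontfun: "P w \<in> bcontfun" for w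
  proof (rule bcontfun_normI)
    have "continuous_on {0..} (\<lambda>u. integral {0..u} (?h w))"
      using integral_deriv by (intro continuous_on_vector_derivative) auto
    then have "continuous_on UNIV (\<lambda>t. integral {0..max 0 t} (?h w))"
      by (rule continuous_on_compose2) (auto intro!: continuous_intros)
    then show "continuous_on UNIV (P w)"
      unfolding P_def by (intro continuous_intros)
  next
    fix t :: real
    let ?C = "norm (G 0) + K * norm w"
    have "norm (?h w s) \<le> ?C * exp (\<kappa> * s)" if "s \<in> {0..max 0 t}" for s
    proof -
      have "norm (?h w s) \<le> norm (G 0) + norm (?h w s - G 0)"
        by (metis add.commute diff_add_cancel norm_triangle_ineq)
      also have "\<dots> \<le> norm (G 0) * 1 + K * (exp (\<kappa> * s) * norm (w s))"
        using GK[of "exp (\<kappa> * s) *\<^sub>R w s" 0] by simp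
      also have "\<dots> \<le> norm (G 0) * exp (\<kappa> * s) + K * (exp (\<kappa> * s) * norm w)"
        using that K by (intro add_mono mult_left_mono norm_bounded) auto
      finally show ?thesis by (simp add: algebra_simps)
    qed
    then have "norm (exp (- \<kappa> * max 0 t) *\<^sub>R integral {0..max 0 t} (?h w)) \<le> ?C / \<kappa>"
      using K cont_h by (intro exp_weighted_integral_bound) auto
    moreover have "norm (exp (- \<kappa> * max 0 t) *\<^sub>R z0) \<le> norm z0"
      using K by (simp add: mult_left_le_one_le)
    ultimately show "norm (P w t) \<le> norm z0 + ?C / \<kappa>"
      unfolding P_def scaleR_add_right by (intro norm_triangle_mono)
  qed
  have P_contraction: "dist (P w t) (P w' t) \<le> K / \<kappa> * dist w w'" for w w' t
  proof -
    have "norm (exp (- \<kappa> * max 0 t) *\<^sub>R integral {0..max 0 t} (\<lambda>s. ?h w s - ?h w' s)) \<le> (K * dist w w') / \<kappa>"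
    proof (rule exp_weighted_integral_bound)
      fix s assume "s \<in> {0..max 0 t}"
      have "norm (?h w s - ?h w' s) \<le> K * (exp (\<kappa> * s) * dist (w s) (w' s))"
        using GK[of "exp (\<kappa> * s) *\<^sub>R w s" "exp (\<kappa> * s) *\<^sub>R w' s"]
        by (simp add: dist_norm flip: scaleR_diff_right)
      also have "\<dots> \<le> K * (exp (\<kappa> * s) * dist w w')"
        using K by (intro mult_left_mono dist_bounded) auto
      finally show "norm (?h w s - ?h w' s) \<le> K * dist w w' * exp (\<kappa> * s)"
        by (simp add: algebra_simps)
    qed (use K in \<open>auto intro!: continuous_intros cont_h\<close>)
    moreover have "P w t - P w' t
        = exp (- \<kappa> * max 0 t) *\<^sub>R integral {0..max 0 t} (\<lambda>s. ?h w s - ?h w' s)"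
      unfolding P_def
      by (subst integral_diff[OF integrable_continuous_interval[OF cont_h] integrable_continuous_interval[OF cont_h]])
        (simp add: algebra_simps)
    ultimately show ?thesis
      by (simp add: dist_norm)
  qed
  have "\<exists>!w. Bcontfun (P w) = w"
    using K P_contraction P_bcontfun
    by (intro banach_fix_type[of "K / \<kappa>"]) (auto intro!: dist_bound simp: Bcontfun_inverse)
  then obtain w where "Bcontfun (P w) = w"
    by blast
  then have w: "apply_bcontfun w = P w"
    by (metis Bcontfun_inverse P_bcontfun)
  define z where "z t = z0 + integral {0..t} (?h w)" for t
  have z: "z t = exp (\<kappa> * t) *\<^sub>R w t" if "0 \<le> t" for t
    using that by (subst w) (simp add: P_def z_def exp_minus)
  show ?thesis
  proof
    show "z 0 = z0"
      by (simp add: z_def)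
    fix t :: real assume t: "0 \<le> t"
    have "(z has_vector_derivative ?h w t) (at t within {0..})"
      unfolding z_def
      using has_vector_derivative_add[OF has_vector_derivative_const integral_deriv[OF t]] by simp
    then show "(z has_vector_derivative G (z t)) (at t within {0..})"
      using z[OF t] by simp
  qed
qed

section \<open>Heavy ball trajectories on bounded time intervals\<close>

text \<open>The equation on \<open>[0,\<tau>]\<close> as a first-order system in position and velocity, for an arbitrary force
  field \<open>-g\<close>. Bounded intervals are needed because the truncated equation is, a priori, the true one
  only up to the exit time from a ball.\<close>

definition heavy_ball_arc ::
  "('a::real_normed_vector \<Rightarrow> 'a) \<Rightarrow> real \<Rightarrow> real \<Rightarrow> (real \<Rightarrow> 'a) \<Rightarrow> (real \<Rightarrow> 'a) \<Rightarrow> bool" where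
  "heavy_ball_arc g \<gamma> \<tau> x v \<longleftrightarrow> (\<forall>t\<in>{0..\<tau>}.
     (x has_vector_derivative v t) (at t within {0..\<tau>}) \<and>
     (v has_vector_derivative - g (x t) - \<gamma> *\<^sub>R v t) (at t within {0..\<tau>}))"

lemma heavy_ball_arcD:
  assumes "heavy_ball_arc g \<gamma> \<tau> x v" "t \<in> {0..\<tau>}"
  shows "(x has_vector_derivative v t) (at t within {0..\<tau>})"
    and "(v has_vector_derivative - g (x t) - \<gamma> *\<^sub>R v t) (at t within {0..\<tau>})"
  using assms unfolding heavy_ball_arc_def by blast+

text \<open>The force \<open>h\<close> is a function of time that needs to agree with \<open>g (x t)\<close> only on \<open>[0,\<tau>]\<close>, so that
  solutions of a truncated equation are covered.\<close>

lemma heavy_ball_arc_of_global: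
  assumes xv: "\<forall>t\<ge>0. (x has_vector_derivative v t) (at t within {0..}) \<and>
      (v has_vector_derivative - h t - \<gamma> *\<^sub>R v t) (at t within {0..})"
    and h: "\<And>t. t \<in> {0..\<tau>} \<Longrightarrow> h t = g (x t)"
  shows "heavy_ball_arc g \<gamma> \<tau> x v"
  unfolding heavy_ball_arc_def
proof (intro ballI conjI)
  fix t assume t: "t \<in> {0..\<tau>}"
  then have x: "(x has_vector_derivative v t) (at t within {0..})"
    and v: "(v has_vector_derivative - h t - \<gamma> *\<^sub>R v t) (at t within {0..})"
    using xv by simp_all
  have sub: "{0..\<tau>} \<subseteq> {0..}"
    by auto
  show "(x has_vector_derivative v t) (at t within {0..\<tau>})"
    by (rule has_vector_derivative_within_subset[OF x sub])
  show "(v has_vector_derivative - g (x t) - \<gamma> *\<^sub>R v t) (at t within {0..\<tau>})"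
    using has_vector_derivative_within_subset[OF v sub] h[OF t] by simp
qed

text \<open>Composing \<open>g\<close> with the projection onto \<open>B\<close>, which is nonexpansive, makes the force globally Lipschitz
  without changing it on \<open>B\<close>.\<close>

lemma truncated_heavy_ball_solution:
  fixes g :: "'a::euclidean_space \<Rightarrow> 'a"
  assumes B: "convex B" "closed B" "B \<noteq> {}" and g: "K-lipschitz_on B g"
  obtains x v where "x 0 = x0" "v 0 = v0"
    "\<forall>t\<ge>0. (x has_vector_derivative v t) (at t within {0..}) \<and>
      (v has_vector_derivative - g (closest_point B (x t)) - \<gamma> *\<^sub>R v t) (at t within {0..})"
proof -
  let ?c = "closest_point B"
  have snd_lip: "1-lipschitz_on UNIV (snd :: 'a \<times> 'a \<Rightarrow> 'a)"
    by (rule lipschitz_onI) (simp_all add: dist_snd_le)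
  have c_lip: "1-lipschitz_on UNIV (\<lambda>z :: 'a \<times> 'a. ?c (fst z))"
    by (rule lipschitz_onI)
      (simp_all add: order_trans[OF closest_point_lipschitz[OF B] dist_fst_le])
  have "range (\<lambda>z :: 'a \<times> 'a. ?c (fst z)) \<subseteq> B"
    using closest_point_in_set[OF B(2,3)] by auto
  note gc_lip = lipschitz_on_compose2[OF c_lip lipschitz_on_subset[OF g this]]
  note G_lip = lipschitz_on_Pair[OF snd_lip
      lipschitz_on_diff[OF lipschitz_on_minus[OF gc_lip] lipschitz_on_cmult[OF snd_lip, of \<gamma>]]]
  show thesis
  proof (rule global_solution_of_lipschitz_ode[OF G_lip, of "(x0, v0)"])
    fix z :: "real \<Rightarrow> 'a \<times> 'a"
    assume z0: "z 0 = (x0, v0)"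
      and z: "\<And>t. 0 \<le> t \<Longrightarrow> (z has_vector_derivative
        (snd (z t), - g (?c (fst (z t))) - \<gamma> *\<^sub>R snd (z t))) (at t within {0..})"
    show thesis
    proof (rule that[of "\<lambda>t. fst (z t)" "\<lambda>t. snd (z t)"]; (intro allI impI)?)
      fix t :: real assume "0 \<le> t"
      from bounded_linear.has_vector_derivative[OF bounded_linear_fst z[OF this]]
        bounded_linear.has_vector_derivative[OF bounded_linear_snd z[OF this]]
      show "((\<lambda>t. fst (z t)) has_vector_derivative snd (z t)) (at t within {0..}) \<and>
          ((\<lambda>t. snd (z t)) has_vector_derivative - g (?c (fst (z t))) - \<gamma> *\<^sub>R snd (z t)) (at t within {0..})"
        by simp
    qed (simp_all add: z0)
  qed
qed

lemma has_real_derivative_inner: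
  fixes x y :: "real \<Rightarrow> 'a::real_inner"
  assumes "(x has_vector_derivative x') (at t within S)" "(y has_vector_derivative y') (at t within S)"
  shows "((\<lambda>t. x t \<bullet> y t) has_real_derivative x t \<bullet> y' + x' \<bullet> y t) (at t within S)"
  unfolding has_field_derivative_def
  using has_derivative_inner[OF assms[unfolded has_vector_derivative_def]]
  by (rule has_derivative_eq_rhs) (simp add: fun_eq_iff algebra_simps)

lemma has_real_derivative_along_curve:
  fixes f :: "'a::real_inner \<Rightarrow> real"
  assumes "GDERIV f (x t) :> D" "(x has_vector_derivative v) (at t within S)"
  shows "((\<lambda>t. f (x t)) has_real_derivative v \<bullet> D) (at t within S)"
proof -
  have "((\<lambda>t. f (x t)) has_derivative (\<lambda>h. (h *\<^sub>R v) \<bullet> D)) (at t within S)"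
    by (rule has_derivative_compose[OF assms(2)[unfolded has_vector_derivative_def]
          assms(1)[unfolded gderiv_def]])
  then show ?thesis
    by (simp add: has_field_derivative_def mult.commute[of _ "v \<bullet> D"])
qed

text \<open>Gronwall for the squared phase-space distance of the two arcs; friction only helps.\<close>

lemma heavy_ball_arc_unique:
  fixes g :: "'a::real_inner \<Rightarrow> 'a"
  assumes g: "K-lipschitz_on B g" and "0 \<le> \<gamma>"
    and x: "heavy_ball_arc g \<gamma> \<tau> x v" "\<And>t. t \<in> {0..\<tau>} \<Longrightarrow> x t \<in> B"
    and y: "heavy_ball_arc g \<gamma> \<tau> y w" "\<And>t. t \<in> {0..\<tau>} \<Longrightarrow> y t \<in> B"
    and init: "x 0 = y 0" "v 0 = w 0"
    and t: "t \<in> {0..\<tau>}"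
  shows "x t = y t"
proof -
  let ?e = "\<lambda>t. x t - y t" and ?u = "\<lambda>t. v t - w t"
  let ?a = "\<lambda>t. - (g (x t) - g (y t)) - \<gamma> *\<^sub>R ?u t"
  let ?D = "\<lambda>t. ?e t \<bullet> ?e t + ?u t \<bullet> ?u t"
  have "?D t \<le> exp ((1 + K) * t) * ?D 0"
  proof (rule gronwall_interval[OF _ _ t])
    fix t assume t: "t \<in> {0..\<tau>}"
    have e: "(?e has_vector_derivative ?u t) (at t within {0..\<tau>})"
      by (intro derivative_intros heavy_ball_arcD[OF x(1) t] heavy_ball_arcD[OF y(1) t])
    have "(?u has_vector_derivative (- g (x t) - \<gamma> *\<^sub>R v t) - (- g (y t) - \<gamma> *\<^sub>R w t)) (at t within {0..\<tau>})"
      by (intro derivative_intros heavy_ball_arcD[OF x(1) t] heavy_ball_arcD[OF y(1) t])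
    then have u: "(?u has_vector_derivative ?a t) (at t within {0..\<tau>})"
      by (simp add: algebra_simps)
    show "(?D has_real_derivative (?e t \<bullet> ?u t + ?u t \<bullet> ?e t) + (?u t \<bullet> ?a t + ?a t \<bullet> ?u t)) (at t within {0..\<tau>})"
      by (intro DERIV_add has_real_derivative_inner e u)
    have "?e t \<bullet> ?u t \<le> norm (?e t) * norm (?u t)"
      by (rule norm_cauchy_schwarz)
    moreover have "- (?u t \<bullet> (g (x t) - g (y t))) \<le> norm (?u t) * (K * norm (?e t))"
    proof -
      have "- (?u t \<bullet> (g (x t) - g (y t))) \<le> norm (?u t) * norm (g (x t) - g (y t))"
        using norm_cauchy_schwarz[of "- ?u t" "g (x t) - g (y t)"] by (simp only: inner_minus_left norm_minus_cancel)
      also have "\<dots> \<le> norm (?u t) * (K * norm (?e t))"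
        using lipschitz_on_normD[OF g] x(2) y(2) t by (intro mult_left_mono) auto
      finally show ?thesis .
    qed
    moreover have "?u t \<bullet> ?a t = - (?u t \<bullet> (g (x t) - g (y t))) - \<gamma> * (?u t \<bullet> ?u t)"
      by (simp add: inner_simps)
    moreover have "0 \<le> \<gamma> * (?u t \<bullet> ?u t)"
      using \<open>0 \<le> \<gamma>\<close> by simp
    moreover have "(1 + K) * (2 * (norm (?e t) * norm (?u t))) \<le> (1 + K) * ?D t"
      using lipschitz_on_nonneg[OF g] sum_squares_bound[of "norm (?e t)" "norm (?u t)"]
      by (intro mult_left_mono) (simp_all add: power2_norm_eq_inner algebra_simps)
    ultimately show "(?e t \<bullet> ?u t + ?u t \<bullet> ?e t) + (?u t \<bullet> ?a t + ?a t \<bullet> ?u t) \<le> (1 + K) * ?D t"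
      by (simp only: inner_commute[of "?u t" "?e t"] inner_commute[of "?a t" "?u t"]) (simp add: algebra_simps)
  qed
  then have "?D t \<le> 0"
    using init by simp
  then have "?e t \<bullet> ?e t = 0"
    by (smt (verit) inner_ge_zero)
  then show ?thesis
    by simp
qed

text \<open>Friction dissipates the mechanical energy at the rate \<open>\<gamma> \<parallel>v\<parallel>\<^sup>2\<close>.\<close>

lemma heavy_ball_energy_nonincreasing:
  fixes f :: "'a::real_inner \<Rightarrow> real"
  assumes grad: "\<And>x. GDERIV f x :> g x" and "0 \<le> \<gamma>"
    and arc: "heavy_ball_arc g \<gamma> \<tau> x v" and t: "t \<in> {0..\<tau>}"
  shows "f (x t) + v t \<bullet> v t / 2 \<le> f (x 0) + v 0 \<bullet> v 0 / 2"
proof -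
  have "f (x t) + v t \<bullet> v t / 2 \<le> exp (0 * t) * (f (x 0) + v 0 \<bullet> v 0 / 2)"
  proof (rule gronwall_interval[OF _ _ t])
    fix t assume t: "t \<in> {0..\<tau>}"
    note xv = heavy_ball_arcD[OF arc t]
    let ?a = "- g (x t) - \<gamma> *\<^sub>R v t"
    have "((\<lambda>t. f (x t) + v t \<bullet> v t / 2) has_real_derivative
        v t \<bullet> g (x t) + (v t \<bullet> ?a + ?a \<bullet> v t) / 2) (at t within {0..\<tau>})"
      by (intro DERIV_add DERIV_cdivide has_real_derivative_along_curve[OF grad xv(1)]
          has_real_derivative_inner xv(2))
    then show "((\<lambda>t. f (x t) + v t \<bullet> v t / 2) has_real_derivative - (\<gamma> * (v t \<bullet> v t))) (at t within {0..\<tau>})"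
      by (rule DERIV_cong) (simp add: inner_simps inner_commute field_simps)
    show "- (\<gamma> * (v t \<bullet> v t)) \<le> 0 * (f (x t) + v t \<bullet> v t / 2)"
      using \<open>0 \<le> \<gamma>\<close> by simp
  qed
  then show ?thesis
    by simp
qed

section \<open>Energy dissipation under strong aiming\<close>

lemma open_sublevel:
  assumes "\<And>x. GDERIV f x :> g x"
  shows "open (sublevel f \<alpha>)"
proof -
  have "continuous_on UNIV f"
    using assms[unfolded gderiv_def]
    by (blast intro: continuous_at_imp_continuous_on has_derivative_continuous)
  then show ?thesis
    unfolding sublevel_def by (intro open_Collect_less continuous_on_const)
qed

text \<open>The analytic core of the problem: \<open>p\<close> stands for the projection onto the set of minimizers, \<open>m\<close> for
  the minimum and \<open>s\<close> for the square root of the strong aiming constant. The nearest-point property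
  compares \<open>p x\<close> with the other values of \<open>p\<close>.\<close>

locale aiming_landscape =
  fixes f :: "'a::euclidean_space \<Rightarrow> real" and g p :: "'a \<Rightarrow> 'a" and p' :: "'a \<Rightarrow> 'a \<Rightarrow> 'a"
    and \<alpha> m s :: real
  assumes gradient: "GDERIV f x :> g x"
    and lower_bound: "m \<le> f x"
    and nearest: "x \<in> sublevel f \<alpha> \<Longrightarrow> y \<in> sublevel f \<alpha> \<Longrightarrow> dist x (p x) \<le> dist x (p y)"
    and p_derivative: "x \<in> sublevel f \<alpha> \<Longrightarrow> (p has_derivative p' x) (at x)"
    and aiming: "x \<in> sublevel f \<alpha> \<Longrightarrow>
      f x - m + s\<^sup>2 / 2 * ((x - p x) \<bullet> (x - p x)) \<le> g x \<bullet> (x - p x)"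
    and s_pos: "0 < s"
begin

text \<open>The kinetic energy is taken relative to the velocity \<open>- s (x - p x)\<close>, which points from \<open>x\<close> to \<open>p x\<close>.
  In the model case \<open>f x = s\<^sup>2 \<parallel>x\<parallel>\<^sup>2 / 2\<close>, \<open>p x = 0\<close>, the friction \<open>2 s\<close> is critical and this is the velocity
  of the pure exponential solution \<open>exp (- s t) x\<close>.\<close>

definition lyapunov :: "'a \<Rightarrow> 'a \<Rightarrow> real" where
  "lyapunov x v = f x - m + (v + s *\<^sub>R (x - p x)) \<bullet> (v + s *\<^sub>R (x - p x)) / 2"

lemma lyapunov_ge: "f x - m \<le> lyapunov x v"
  by (simp add: lyapunov_def)

lemma lyapunov_nonneg: "0 \<le> lyapunov x v"
  using lyapunov_ge[of x v] lower_bound[of x] by simp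

text \<open>With \<open>n = x - p x\<close> and \<open>w\<close> the derivative of \<open>p\<close> applied to \<open>v\<close>, the derivative of the Lyapunov function
  is \<open>- s \<parallel>v\<parallel>\<^sup>2 - s (v \<bullet> w) - s (g x \<bullet> n) - s\<^sup>2 (v \<bullet> n) - s\<^sup>2 (n \<bullet> w)\<close>. The last term vanishes, \<open>v \<bullet> w\<close> is
  nonnegative, and strong aiming bounds \<open>g x \<bullet> n\<close>; the result is \<open>- s\<close> times the Lyapunov function,
  with \<open>\<parallel>v\<parallel>\<^sup>2 / 2\<close> to spare.\<close>

lemma lyapunov_dissipation:
  assumes arc: "heavy_ball_arc g (2 * s) \<tau> x v" and t: "t \<in> {0..\<tau>}" and U: "x t \<in> sublevel f \<alpha>"
  obtains d where "((\<lambda>t. lyapunov (x t) (v t)) has_real_derivative d) (at t within {0..\<tau>})"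
    and "d \<le> - s * (lyapunov (x t) (v t) + v t \<bullet> v t / 2)"
proof -
  note xv = heavy_ball_arcD[OF arc t]
  define n where "n = x t - p (x t)"
  define w where "w = p' (x t) (v t)"
  interpret p': bounded_linear "p' (x t)"
    using p_derivative[OF U] by (rule has_derivative_bounded_linear)
  have px: "((\<lambda>t. p (x t)) has_vector_derivative w) (at t within {0..\<tau>})"
    using has_derivative_compose[OF xv(1)[unfolded has_vector_derivative_def] p_derivative[OF U]]
    by (simp add: has_vector_derivative_def p'.scaleR w_def)
  let ?a = "- g (x t) - (2 * s) *\<^sub>R v t"
  let ?q = "\<lambda>t. v t + s *\<^sub>R (x t - p (x t))"
  have q: "(?q has_vector_derivative ?a + s *\<^sub>R (v t - w)) (at t within {0..\<tau>})"
    by (intro has_vector_derivative_add has_vector_derivative_diff xv px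
        bounded_linear.has_vector_derivative[OF bounded_linear_scaleR_right])
  define d where "d = v t \<bullet> g (x t) + (v t + s *\<^sub>R n) \<bullet> (?a + s *\<^sub>R (v t - w))"
  show ?thesis
  proof
    let ?b = "?a + s *\<^sub>R (v t - w)"
    have "((\<lambda>t. lyapunov (x t) (v t)) has_real_derivative
        (v t \<bullet> g (x t) - 0) + (?q t \<bullet> ?b + ?b \<bullet> ?q t) / 2) (at t within {0..\<tau>})"
      unfolding lyapunov_def
      by (intro DERIV_add DERIV_diff DERIV_const DERIV_cdivide
          has_real_derivative_along_curve[OF gradient xv(1)] has_real_derivative_inner q)
    then show "((\<lambda>t. lyapunov (x t) (v t)) has_real_derivative d) (at t within {0..\<tau>})"
      by (rule DERIV_cong) (simp add: d_def n_def inner_commute)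
    have nw: "n \<bullet> w = 0"
      unfolding n_def w_def
      using nearest_point_map_derivative_orthogonal[OF open_sublevel[OF gradient] U nearest[OF U] p_derivative[OF U]] .
    have vw: "0 \<le> v t \<bullet> w"
      unfolding w_def
      using nearest_point_map_derivative_nonneg[OF open_sublevel[OF gradient] U nearest p_derivative[OF U]] .
    have "d = - s * (v t \<bullet> v t) - s * (v t \<bullet> w) - s * (g (x t) \<bullet> n) - s\<^sup>2 * (v t \<bullet> n)"
      using nw by (simp add: d_def inner_simps inner_commute power2_eq_square algebra_simps)
    moreover have "s * (f (x t) - m + s\<^sup>2 / 2 * (n \<bullet> n)) \<le> s * (g (x t) \<bullet> n)"
      using aiming[OF U] s_pos by (simp add: n_def)
    moreover have "0 \<le> s * (v t \<bullet> w)"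
      using vw s_pos by simp
    moreover have "- s * (lyapunov (x t) (v t) + v t \<bullet> v t / 2)
        = - s * (v t \<bullet> v t) - s * (f (x t) - m + s\<^sup>2 / 2 * (n \<bullet> n)) - s\<^sup>2 * (v t \<bullet> n)"
      by (simp add: lyapunov_def inner_simps inner_commute power2_eq_square algebra_simps
          add_divide_distrib diff_divide_distrib flip: n_def)
    ultimately show "d \<le> - s * (lyapunov (x t) (v t) + v t \<bullet> v t / 2)"
      by linarith
  qed
qed

context
  fixes \<tau> :: real and x v :: "real \<Rightarrow> 'a"
  assumes arc: "heavy_ball_arc g (2 * s) \<tau> x v" and start: "x 0 \<in> sublevel f \<alpha>" "v 0 = 0"
begin

lemma arc_stays_in_sublevel:
  assumes "t \<in> {0..\<tau>}"
  shows "x t \<in> sublevel f \<alpha>"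
proof -
  have "f (x t) + v t \<bullet> v t / 2 \<le> f (x 0)"
    using heavy_ball_energy_nonincreasing[OF gradient _ arc assms] start s_pos by simp
  moreover have "0 \<le> v t \<bullet> v t / 2"
    by simp
  ultimately show ?thesis
    using start unfolding sublevel_def mem_Collect_eq by linarith
qed

lemma lyapunov_derivative_along_arc:
  obtains L' where "\<forall>t\<in>{0..\<tau>}.
    ((\<lambda>t. lyapunov (x t) (v t)) has_real_derivative L' t) (at t within {0..\<tau>}) \<and>
    L' t \<le> - s * (lyapunov (x t) (v t) + v t \<bullet> v t / 2)"
proof -
  have "\<forall>t\<in>{0..\<tau>}. \<exists>d.
    ((\<lambda>t. lyapunov (x t) (v t)) has_real_derivative d) (at t within {0..\<tau>}) \<and>
    d \<le> - s * (lyapunov (x t) (v t) + v t \<bullet> v t / 2)"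
    (is "\<forall>t\<in>_. \<exists>d. ?P t d")
  proof
    fix t assume t: "t \<in> {0..\<tau>}"
    show "\<exists>d. ?P t d"
      by (rule lyapunov_dissipation[OF arc t arc_stays_in_sublevel[OF t]]) blast
  qed
  then have "\<exists>L'. \<forall>t\<in>{0..\<tau>}. ?P t (L' t)"
    by (rule bchoice)
  then show thesis
    using that by blast
qed

lemma lyapunov_decay:
  assumes t: "t \<in> {0..\<tau>}"
  shows "lyapunov (x t) (v t) \<le> exp (- s * t) * lyapunov (x 0) (v 0)"
proof -
  let ?L = "\<lambda>t. lyapunov (x t) (v t)"
  obtain L' where deriv: "\<forall>t\<in>{0..\<tau>}. (?L has_real_derivative L' t) (at t within {0..\<tau>}) \<and>
      L' t \<le> - s * (?L t + v t \<bullet> v t / 2)"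
    using lyapunov_derivative_along_arc .
  have L': "(?L has_real_derivative L' t) (at t within {0..\<tau>})"
    "L' t \<le> - s * (?L t + v t \<bullet> v t / 2)" if "t \<in> {0..\<tau>}" for t
    using deriv that by simp_all
  show ?thesis
  proof (rule gronwall_interval[OF L'(1) _ t])
    show "L' t \<le> - s * lyapunov (x t) (v t)" if "t \<in> {0..\<tau>}" for t
    proof -
      have "0 \<le> s * (v t \<bullet> v t / 2)"
        using s_pos by simp
      moreover have "L' t \<le> - s * lyapunov (x t) (v t) - s * (v t \<bullet> v t / 2)"
        using L'(2)[OF that] by (simp add: distrib_left)
      ultimately show ?thesis
        by linarith
    qed
  qed
qed

text \<open>By the arithmetic-geometric mean inequality, \<open>\<parallel>v\<parallel> \<le> exp (s t) \<parallel>v\<parallel>\<^sup>2 / 2 + exp (- s t) / 2\<close>. The dissipation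
  inequality bounds the first summand by the derivative of \<open>- exp (s t) L / s\<close>; the second one is
  integrable. So the displacement is bounded independently of \<open>\<tau>\<close>.\<close>

lemma arc_length_bound:
  assumes t: "t \<in> {0..\<tau>}"
  shows "norm (x t - x 0) \<le> (lyapunov (x 0) (v 0) + 1 / 2) / s"
proof (cases "t = 0")
  case True
  then show ?thesis
    using lyapunov_nonneg[of "x 0" "v 0"] s_pos by simp
next
  case False
  let ?L = "\<lambda>t. lyapunov (x t) (v t)"
  obtain L' where deriv: "\<forall>t\<in>{0..\<tau>}. (?L has_real_derivative L' t) (at t within {0..\<tau>}) \<and>
      L' t \<le> - s * (?L t + v t \<bullet> v t / 2)"
    using lyapunov_derivative_along_arc .
  have L': "(?L has_real_derivative L' t) (at t within {0..\<tau>})"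
    "L' t \<le> - s * (?L t + v t \<bullet> v t / 2)" if "t \<in> {0..\<tau>}" for t
    using deriv that by simp_all
  \<comment> \<open>A function whose derivative dominates the speed.\<close>
  let ?\<phi> = "\<lambda>r. - (exp (s * r) * ?L r + exp (- s * r) / 2) / s"
  have "norm (x t - x 0) \<le> ?\<phi> t - ?\<phi> 0"
  proof (rule differentiable_bound_general)
    show "0 < t"
      using False t by simp
    have "continuous_on {0..\<tau>} x"
      using heavy_ball_arcD(1)[OF arc] by (rule continuous_on_vector_derivative)
    moreover have "continuous_on {0..\<tau>} ?L"
      using L'(1) by (rule DERIV_continuous_on)
    ultimately have "continuous_on {0..t} x" "continuous_on {0..t} ?L"
      using t by (auto elim: continuous_on_subset)
    then show "continuous_on {0..t} x" "continuous_on {0..t} ?\<phi>"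
      using s_pos by (auto intro!: continuous_intros)
    fix r assume r: "0 < r" "r < t"
    then have r\<tau>: "r \<in> {0..\<tau>}" and at_r: "at r within {0..\<tau>} = at r"
      using t by (auto intro: at_within_Icc_at)
    show "(x has_vector_derivative v r) (at r)"
      using heavy_ball_arcD(1)[OF arc r\<tau>] by (simp add: at_r)
    let ?\<phi>' = "- (exp (s * r) * (s * ?L r + L' r)) / s + exp (- s * r) / 2"
    have "(?\<phi> has_real_derivative ?\<phi>') (at r)"
      using L'(1)[OF r\<tau>] s_pos
      by (auto intro!: derivative_eq_intros simp: at_r field_simps)
    then show "(?\<phi> has_vector_derivative ?\<phi>') (at r)"
      by (simp add: has_real_derivative_iff_has_vector_derivative)
    have "norm (v r) \<le> exp (s * r) * (v r \<bullet> v r) / 2 + exp (- s * r) / 2"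
    proof -
      have "0 \<le> (exp (s * r) * norm (v r) - 1)\<^sup>2"
        by simp
      then have "2 * norm (v r) * exp (s * r) \<le> (exp (s * r) * (v r \<bullet> v r)) * exp (s * r) + 1"
        by (simp add: power2_diff power_mult_distrib power2_norm_eq_inner) (simp add: power2_eq_square algebra_simps)
      then show ?thesis
        by (simp add: exp_minus field_simps)
    qed
    also have "exp (s * r) * (v r \<bullet> v r) / 2 \<le> - (exp (s * r) * (s * ?L r + L' r)) / s"
    proof -
      have "exp (s * r) * (s * ?L r + L' r) \<le> exp (s * r) * (- s * (v r \<bullet> v r) / 2)"
        using L'(2)[OF r\<tau>] by (intro mult_left_mono) (simp_all add: algebra_simps)
      then show ?thesis
        using s_pos by (simp add: field_simps)
    qed
    finally show "norm (v r) \<le> ?\<phi>'"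
      by simp
  qed
  also have "\<dots> = (?L 0 + 1 / 2) / s - (exp (s * t) * ?L t + exp (- s * t) / 2) / s"
    by (simp add: diff_divide_distrib add_divide_distrib)
  also have "\<dots> \<le> (?L 0 + 1 / 2) / s"
    using lyapunov_nonneg[of "x t" "v t"] s_pos by simp
  finally show ?thesis .
qed

end

text \<open>The force is truncated outside a ball whose radius exceeds the bound \<open>R\<close> on the displacement by \<open>1\<close>.
  As long as the solution stays in that ball it solves the true equation, hence moves by at most
  \<open>R\<close>; by continuity it never leaves the ball.\<close>

lemma heavy_ball_global_existence:
  assumes g: "locally_lipschitz g" and x0: "x0 \<in> sublevel f \<alpha>"
  obtains x v where "x 0 = x0" "v 0 = 0"
    "\<forall>t\<ge>0. (x has_vector_derivative v t) (at t within {0..}) \<and>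
      (v has_vector_derivative - g (x t) - (2 * s) *\<^sub>R v t) (at t within {0..})"
proof -
  define R where "R = (lyapunov x0 0 + 1 / 2) / s"
  define B where "B = cball x0 (R + 1)"
  have "0 \<le> R"
    using lyapunov_nonneg[of x0 0] s_pos by (simp add: R_def)
  then have B: "convex B" "closed B" "B \<noteq> {}" "compact B"
    by (auto simp: B_def)
  obtain K where K: "K-lipschitz_on B g"
    using locally_lipschitz_imp_lipschitz_on_compact[OF g B(4)] .
  let ?c = "closest_point B"
  obtain x v where init: "x 0 = x0" "v 0 = 0"
    and xv: "\<forall>t\<ge>0. (x has_vector_derivative v t) (at t within {0..}) \<and>
      (v has_vector_derivative - g (?c (x t)) - (2 * s) *\<^sub>R v t) (at t within {0..})"
    using truncated_heavy_ball_solution[OF B(1-3) K, of x0 0 "2 * s"] .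
  have cx: "?c (x t) = x t" if "norm (x t - x0) \<le> R + 1" for t
    using that by (intro closest_point_self) (simp add: B_def dist_norm norm_minus_commute)
  have cont: "continuous_on {0..} x"
    by (rule continuous_on_vector_derivative[where f' = v]) (use xv in simp)
  have bound: "norm (x t - x0) \<le> R" if "0 \<le> t" for t
  proof (rule continuity_bootstrap[of "\<lambda>t. norm (x t - x0)" _ "R + 1"])
    show "continuous_on {0..} (\<lambda>t. norm (x t - x0))"
      by (intro continuous_intros cont)
    fix \<tau> :: real assume \<tau>: "0 \<le> \<tau>" and "\<And>t. t \<in> {0..\<tau>} \<Longrightarrow> norm (x t - x0) \<le> R + 1"
    then have arc: "heavy_ball_arc g (2 * s) \<tau> x v"
      by (intro heavy_ball_arc_of_global[OF xv]) (simp_all add: cx)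
    show "norm (x \<tau> - x0) \<le> R"
      using arc_length_bound[OF arc, of \<tau>] \<tau> x0 by (simp add: init R_def)
  qed (use that init \<open>0 \<le> R\<close> in auto)
  have "?c (x t) = x t" if "0 \<le> t" for t
    using cx[of t] bound[OF that] by simp
  with xv have "\<forall>t\<ge>0. (x has_vector_derivative v t) (at t within {0..}) \<and>
      (v has_vector_derivative - g (x t) - (2 * s) *\<^sub>R v t) (at t within {0..})"
    by simp
  then show ?thesis
    by (rule that[of x v, OF init])
qed

end

section \<open>Classical solutions: uniqueness and regularity\<close>

lemma heavy_ball_solution_iff:
  "heavy_ball_solution f \<gamma> x0 x \<longleftrightarrow> (\<exists>v. x 0 = x0 \<and> v 0 = 0 \<and> (\<forall>t\<ge>0.
     (x has_vector_derivative v t) (at t within {0..}) \<and>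
     (v has_vector_derivative - gradient f (x t) - \<gamma> *\<^sub>R v t) (at t within {0..})))"
    (is "?lhs \<longleftrightarrow> ?rhs")
proof
  assume ?lhs
  then obtain v a where va: "x 0 = x0" "v 0 = 0" "\<forall>t\<ge>0.
     (x has_vector_derivative v t) (at t within {0..}) \<and>
     (v has_vector_derivative a t) (at t within {0..}) \<and> a t + \<gamma> *\<^sub>R v t = - gradient f (x t)"
    unfolding heavy_ball_solution_def by blast
  moreover have "a t = - gradient f (x t) - \<gamma> *\<^sub>R v t" if "0 \<le> t" for t
    using va(3) that by (metis add_diff_cancel_right')
  ultimately show ?rhs
    by (intro exI[of _ v]) auto
next
  assume ?rhs
  then obtain v where v: "x 0 = x0" "v 0 = 0" "\<forall>t\<ge>0.
     (x has_vector_derivative v t) (at t within {0..}) \<and>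
     (v has_vector_derivative - gradient f (x t) - \<gamma> *\<^sub>R v t) (at t within {0..})"
    by blast
  show ?lhs
    unfolding heavy_ball_solution_def
    by (rule exI[of _ v], rule exI[of _ "\<lambda>t. - gradient f (x t) - \<gamma> *\<^sub>R v t"]) (use v in simp)
qed

text \<open>Up to time \<open>t\<close>, both trajectories stay in a compact set, on which the gradient is Lipschitz.\<close>

lemma heavy_ball_solution_unique:
  assumes g: "locally_lipschitz (gradient f)" and "0 \<le> \<gamma>"
    and x: "heavy_ball_solution f \<gamma> x0 x" and y: "heavy_ball_solution f \<gamma> x0 y" and "0 \<le> t"
  shows "x t = y t"
proof -
  obtain v where v: "x 0 = x0" "v 0 = 0" "\<forall>t\<ge>0. (x has_vector_derivative v t) (at t within {0..}) \<and>
      (v has_vector_derivative - gradient f (x t) - \<gamma> *\<^sub>R v t) (at t within {0..})"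
    using x unfolding heavy_ball_solution_iff by blast
  obtain w where w: "y 0 = x0" "w 0 = 0" "\<forall>t\<ge>0. (y has_vector_derivative w t) (at t within {0..}) \<and>
      (w has_vector_derivative - gradient f (y t) - \<gamma> *\<^sub>R w t) (at t within {0..})"
    using y unfolding heavy_ball_solution_iff by blast
  define B where "B = x ` {0..t} \<union> y ` {0..t}"
  have "continuous_on {0..} x"
    by (rule continuous_on_vector_derivative[where f' = v]) (use v(3) in simp)
  moreover have "continuous_on {0..} y"
    by (rule continuous_on_vector_derivative[where f' = w]) (use w(3) in simp)
  ultimately have "continuous_on {0..t} x" "continuous_on {0..t} y"
    by (auto elim: continuous_on_subset)
  then have "compact B"
    unfolding B_def by (intro compact_Un compact_continuous_image) auto
  then obtain K where K: "K-lipschitz_on B (gradient f)"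
    using locally_lipschitz_imp_lipschitz_on_compact[OF g] by blast
  show ?thesis
    by (rule heavy_ball_arc_unique[OF K \<open>0 \<le> \<gamma>\<close> heavy_ball_arc_of_global[OF v(3) refl] _
          heavy_ball_arc_of_global[OF w(3) refl], where \<tau> = t])
      (use v w \<open>0 \<le> t\<close> in \<open>auto simp: B_def\<close>)
qed

lemma C1_on_has_gradient:
  fixes f :: "'a::euclidean_space \<Rightarrow> real"
  assumes "C1_on UNIV f"
  shows "GDERIV f x :> gradient f x"
proof -
  obtain f' where f': "(f has_derivative f') (at x)"
    using assms unfolding C1_on_def by auto
  define D where "D = (\<Sum>b\<in>Basis. f' b *\<^sub>R b)"
  interpret f': bounded_linear f'
    using f' by (rule has_derivative_bounded_linear)
  have "f' h = h \<bullet> D" for h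
  proof -
    have "f' h = f' (\<Sum>b\<in>Basis. (h \<bullet> b) *\<^sub>R b)"
      by (simp add: euclidean_representation)
    also have "\<dots> = h \<bullet> D"
      by (simp add: D_def f'.sum f'.scaleR inner_sum_right mult.commute)
    finally show ?thesis .
  qed
  then have "f' = (\<lambda>h. h \<bullet> D)"
    by (rule ext)
  from f'[unfolded this] have D: "GDERIV f x :> D"
    unfolding gderiv_def .
  show ?thesis
    unfolding gradient_def
  proof (rule theI)
    fix E assume "GDERIV f x :> E"
    then have "(\<lambda>h. h \<bullet> E) = (\<lambda>h. h \<bullet> D)"
      using D unfolding gderiv_def by (rule has_derivative_unique)
    then show "E = D"
      by (metis vector_eq_ldot)
  qed (rule D)
qed

lemma C1_on_if_has_vector_derivative:
  assumes "\<And>t. t \<in> S \<Longrightarrow> (x has_vector_derivative v t) (at t within S)" "continuous_on S v"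
  shows "C1_on S x"
  unfolding C1_on_def
proof (intro exI[of _ "\<lambda>t. blinfun_scaleR_left (v t)"] conjI ballI)
  show "continuous_on S (\<lambda>t. blinfun_scaleR_left (v t))"
    by (rule bounded_linear.continuous_on[OF bounded_linear_blinfun_scaleR_left assms(2)])
qed (use assms(1) in \<open>simp add: has_vector_derivative_def\<close>)

text \<open>The derivative of \<open>x\<close> at \<open>t\<close>, as a linear map \<open>h \<mapsto> h v(t)\<close>, is the image of \<open>v t\<close> under a fixed
  bounded linear map and so inherits the smoothness of \<open>v\<close>.\<close>

lemma C2_on_if_has_vector_derivative:
  assumes x: "\<And>t. t \<in> S \<Longrightarrow> (x has_vector_derivative v t) (at t within S)"
    and v: "\<And>t. t \<in> S \<Longrightarrow> (v has_vector_derivative a t) (at t within S)" and a: "continuous_on S a"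
  shows "C2_on S x"
  unfolding C2_on_def
proof (intro exI[of _ "\<lambda>t. blinfun_scaleR_left (v t)"] conjI ballI)
  show "C1_on S (\<lambda>t. blinfun_scaleR_left (v t))"
    by (rule C1_on_if_has_vector_derivative[where v = "\<lambda>t. blinfun_scaleR_left (a t)"])
      (auto intro: bounded_linear.has_vector_derivative[OF bounded_linear_blinfun_scaleR_left] v
        bounded_linear.continuous_on[OF bounded_linear_blinfun_scaleR_left a])
qed (use x in \<open>simp add: has_vector_derivative_def\<close>)

section \<open>Accelerated convergence of the heavy ball\<close>

lemma infdist_eq_dist_nearest:
  assumes "z \<in> A" "\<And>y. y \<in> A \<Longrightarrow> dist x z \<le> dist x y"
  shows "infdist x A = dist x z"
  using assms by (intro antisym infdist_le) (auto simp: infdist_def intro!: cINF_greatest)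

theorem theorem6:
  fixes f :: "real ^ 'd \<Rightarrow> real" and k :: nat and \<alpha> \<mu> \<gamma> :: real and x0 :: "real ^ 'd"
    and \<pi> :: "real ^ 'd \<Rightarrow> real ^ 'd"
  assumes "bdd_below (range f)" and "C1_on UNIV f" and "locally_lipschitz (gradient f)"
    and "minimizers f \<noteq> {}" and "C2_submanifold k (minimizers f)" and "k < CARD('d)"
    and "\<alpha> > 0"
    and "\<forall>x\<in>sublevel f \<alpha>. \<exists>!z. z \<in> minimizers f \<and> (\<forall>y\<in>minimizers f. dist x z \<le> dist x y)"
    and "\<pi> = closest_point (minimizers f)" and "C1_on (sublevel f \<alpha>) \<pi>"
    and "\<mu> > 0" and "strong_aiming f \<pi> \<mu> (sublevel f \<alpha>)"
    and "\<gamma> = 2 * sqrt \<mu>" and "f x0 < \<alpha>"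
  shows "\<exists>x. heavy_ball_solution f \<gamma> x0 x \<and>
     (\<forall>y. heavy_ball_solution f \<gamma> x0 y \<longrightarrow> (\<forall>t\<ge>0. y t = x t)) \<and>
     (\<forall>t>0. f (x t) < \<alpha>) \<and>
     C2_on {0..} x \<and>
     (\<forall>t\<ge>0. f (x t) - (INF z. f z)
        \<le> exp (- sqrt \<mu> * t) * (f x0 - (INF z. f z) + \<mu> / 2 * (infdist x0 (minimizers f))\<^sup>2))"
proof -
  define M where "M = minimizers f"
  define m where "m = (INF z. f z)"
  define s where "s = sqrt \<mu>"
  have s: "0 < s" "s\<^sup>2 = \<mu>" "\<gamma> = 2 * s"
    using assms(11,13) by (simp_all add: s_def)
  have closest: "\<pi> x \<in> M \<and> (\<forall>y\<in>M. dist x (\<pi> x) \<le> dist x y)" if "x \<in> sublevel f \<alpha>" for x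
  proof -
    have "\<exists>z. z \<in> M \<and> (\<forall>y\<in>M. dist x z \<le> dist x y)"
      using assms(8) that unfolding M_def by blast
    then show ?thesis
      unfolding assms(9) closest_point_def M_def[symmetric] by (rule someI_ex)
  qed
  have f\<pi>: "f (\<pi> x) = m" if "x \<in> sublevel f \<alpha>" for x
    using closest[OF that] by (simp add: M_def minimizers_def m_def)
  have grad: "GDERIV f x :> gradient f x" for x
    using assms(2) by (rule C1_on_has_gradient)
  have "open (sublevel f \<alpha>)"
    using grad by (rule open_sublevel)
  then obtain \<pi>' where \<pi>': "\<And>x. x \<in> sublevel f \<alpha> \<Longrightarrow> (\<pi> has_derivative blinfun_apply (\<pi>' x)) (at x)"
    using assms(10) unfolding C1_on_def by (metis at_within_open)
  interpret aiming_landscape f "gradient f" \<pi> "\<lambda>x. blinfun_apply (\<pi>' x)" \<alpha> m s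
  proof
    show "m \<le> f x" for x
      unfolding m_def using assms(1) by (intro cINF_lower) auto
    show "f x - m + s\<^sup>2 / 2 * ((x - \<pi> x) \<bullet> (x - \<pi> x)) \<le> gradient f x \<bullet> (x - \<pi> x)"
      if "x \<in> sublevel f \<alpha>" for x
      using bspec[OF assms(12)[unfolded strong_aiming_def] that]
      by (simp add: f\<pi>[OF that] s(2) power2_norm_eq_inner)
  qed (use grad closest \<pi>' s in auto)
  have x0: "x0 \<in> sublevel f \<alpha>"
    using assms(14) by (simp add: sublevel_def)
  obtain x v where x: "x 0 = x0" "v 0 = 0"
    "\<forall>t\<ge>0. (x has_vector_derivative v t) (at t within {0..}) \<and>
      (v has_vector_derivative - gradient f (x t) - (2 * s) *\<^sub>R v t) (at t within {0..})"
    using heavy_ball_global_existence[OF assms(3) x0] .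
  have arc: "heavy_ball_arc (gradient f) (2 * s) t x v" for t
    by (rule heavy_ball_arc_of_global[OF x(3) refl])
  have start: "x 0 \<in> sublevel f \<alpha>" "v 0 = 0"
    using x x0 by simp_all
  show ?thesis
  proof (intro exI[of _ x] conjI allI impI)
    show sol: "heavy_ball_solution f \<gamma> x0 x"
      unfolding heavy_ball_solution_iff s(3) using x by blast
    show "y t = x t" if "heavy_ball_solution f \<gamma> x0 y" "0 \<le> t" for y t
      using heavy_ball_solution_unique[OF assms(3) _ that(1) sol that(2)] s by simp
    show "f (x t) < \<alpha>" if "0 < t" for t
      using arc_stays_in_sublevel[OF arc start, of t t] that by (simp add: sublevel_def)
    have x': "(x has_vector_derivative v t) (at t within {0..})"
      and v': "(v has_vector_derivative - gradient f (x t) - (2 * s) *\<^sub>R v t) (at t within {0..})"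
      if "t \<in> {0..}" for t
      using x(3) that by simp_all
    have "continuous_on {0..} x" "continuous_on {0..} v"
      by (rule continuous_on_vector_derivative, fact x', rule continuous_on_vector_derivative, fact v')
    then have "continuous_on {0..} (\<lambda>t. - gradient f (x t) - (2 * s) *\<^sub>R v t)"
      using continuous_on_compose2[OF locally_lipschitz_imp_continuous[OF assms(3)]]
      by (intro continuous_intros) auto
    with x' v' show "C2_on {0..} x"
      by (rule C2_on_if_has_vector_derivative)
    fix t :: real assume "0 \<le> t"
    then have "lyapunov (x t) (v t) \<le> exp (- s * t) * lyapunov (x 0) (v 0)"
      using lyapunov_decay[OF arc start, of t t] by simp
    moreover have "lyapunov (x 0) (v 0) = f x0 - m + \<mu> / 2 * (infdist x0 M)\<^sup>2"
      using infdist_eq_dist_nearest[of "\<pi> x0" M x0] closest[OF x0]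
      by (simp add: lyapunov_def x dist_norm power2_norm_eq_inner)
        (simp add: power2_eq_square flip: s(2))
    ultimately show "f (x t) - (INF z. f z)
        \<le> exp (- sqrt \<mu> * t) * (f x0 - (INF z. f z) + \<mu> / 2 * (infdist x0 (minimizers f))\<^sup>2)"
      using lyapunov_ge[of "x t" "v t"] by (simp add: m_def M_def s_def)
  qed
qed

end
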